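(* For every integer $n\ge1$ the Zagier polynomials satisfy $$B_n^{*}(-x-3)=(-1)^nB_n^{*}(x).$$
   Context: The Bernoulli polynomials $B_r(x)$ are defined by $\frac{te^{xt}}{e^t-1}=\sum_{r=0}^\infty B_r(x)\frac{t^r}{r!}$. For an integer $n>0$ the Zagier polynomial is $B_n^{*}(x)=\sum_{r=0}^{n}\binom{n+r}{2r}\frac{B_r(x)}{n+r}$. *)

theory Defs
  imports Complex_Main "HOL-Computational_Algebra.Formal_Power_Series"
begin

text \<open>
  Polynomials are rendered by their values at an arbitrary point of an arbitrary field of
  characteristic 0.  As the field is arbitrary, taking \<open>x\<close> to be an indeterminate (an element of
  a field of rational functions) gives the identities between polynomials.
\<close>

definition bernoulli_gf :: "'a::field_char_0 \<Rightarrow> 'a fps" where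
  "bernoulli_gf x = fps_X * fps_exp x / (fps_exp 1 - 1)"

definition bernoulli_poly :: "nat \<Rightarrow> 'a::field_char_0 \<Rightarrow> 'a" where
  "bernoulli_poly r x = fact r * fps_nth (bernoulli_gf x) r"

definition zagier_poly :: "nat \<Rightarrow> 'a::field_char_0 \<Rightarrow> 'a" where
  "zagier_poly n x =
     (\<Sum>r=0..n. of_nat ((n + r) choose (2 * r)) * (bernoulli_poly r x / of_nat (n + r)))"

text \<open>
  The denominator \<open>fps_exp 1 - 1\<close> is not a unit, but its subdegree is 1, so that the division
  is exact.
\<close>

lemma bernoulli_gf_mult:
  "bernoulli_gf x * (fps_exp 1 - 1) = (fps_X * fps_exp x :: 'a::field_char_0 fps)"
proof -
  have nz: "fps_nth (fps_exp 1 - 1 :: 'a fps) 1 \<noteq> 0"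
    by simp
  have ne: "fps_exp 1 - 1 \<noteq> (0 :: 'a fps)"
    using nz by (metis fps_zero_nth)
  have "subdegree (fps_exp 1 - 1 :: 'a fps) = 1"
    using nz by (intro subdegreeI) auto
  moreover have "subdegree (fps_X * fps_exp x :: 'a fps) = 1"
    by (rule subdegreeI) auto
  ultimately have "fps_exp 1 - 1 dvd (fps_X * fps_exp x :: 'a fps)"
    using ne by (subst fps_dvd_iff) auto
  then show ?thesis
    by (simp add: bernoulli_gf_def)
qed

lemma bernoulli_poly_generating_function:
  "Abs_fps (\<lambda>r. bernoulli_poly r x / fact r) = fps_X * fps_exp x / (fps_exp 1 - 1)"
  by (rule fps_ext) (simp add: bernoulli_poly_def bernoulli_gf_def)

end

theory Submission
  imports Defs "HOL-Computational_Algebra.Polynomial"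
begin

text \<open>
  Let \<open>L\<^sub>x\<close> be the linear functional on polynomials with \<open>L\<^sub>x (y\<^sup>r) = B\<^sub>r(x)\<close>.  The addition
  formula and the reflection formula for the Bernoulli polynomials combine to
  \<open>L\<^bsub>-x-3\<^esub> p(y) = L\<^sub>x p(-4-y)\<close>.  Now \<open>2n B\<^sub>n\<^sup>*(x) = L\<^sub>x q\<close> with
  \<open>q = 2 T\<^sub>n(1 + y/2) = U\<^sub>n(1 + y/2) - U\<^sub>n\<^sub>-\<^sub>2(1 + y/2)\<close>, and the substitution \<open>y \<mapsto> -4-y\<close> negates
  the argument of the Chebyshev polynomials.
\<close>

lemma fps_exp_minus_one_nonzero: "fps_exp 1 - 1 \<noteq> (0 :: 'a::field_char_0 fps)"
proof
  assume "fps_exp 1 - 1 = (0 :: 'a fps)"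
  then have "fps_nth (fps_exp 1 - 1 :: 'a fps) 1 = 0" by simp
  then show False by simp
qed

lemma bernoulli_gf_add: "bernoulli_gf (x + c) = bernoulli_gf x * fps_exp (c :: 'a::field_char_0)"
proof -
  have "bernoulli_gf (x + c) * (fps_exp 1 - 1) = bernoulli_gf x * (fps_exp 1 - 1) * fps_exp c"
    by (simp only: bernoulli_gf_mult fps_exp_add_mult mult.assoc)
  also have "\<dots> = (bernoulli_gf x * fps_exp c) * (fps_exp 1 - 1)"
    by (simp only: mult_ac)
  finally show ?thesis
    using fps_exp_minus_one_nonzero by (metis mult_right_cancel)
qed

text \<open>Replacing \<open>t\<close> by \<open>-t\<close> turns
  \<open>t e^(xt) / (e^t - 1)\<close> into \<open>-t e^(-xt) / (e^(-t) - 1)\<close>; expanding this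
  fraction by \<open>-e^t\<close> gives the generating function at \<open>1 - x\<close>.\<close>

lemma bernoulli_gf_reflect:
  "bernoulli_gf (1 - x) = bernoulli_gf x oo (- fps_X :: 'a::field_char_0 fps)"
proof -
  let ?E = "fps_exp (- 1) :: 'a fps"
  have e: "fps_exp c oo - fps_X = fps_exp (- c)" for c :: 'a
    using fps_compose_uminus'[of "fps_exp c"]
    by (simp add: fps_eq_iff power_minus')
  have "(bernoulli_gf x * (fps_exp 1 - 1)) oo - fps_X = (fps_X * fps_exp x) oo (- fps_X :: 'a fps)"
    by (simp only: bernoulli_gf_mult)
  then have r: "(bernoulli_gf x oo - fps_X) * (?E - 1) = - fps_X * fps_exp (- x)"
    by (simp add: fps_compose_mult_distrib fps_compose_sub_distrib e)
  have i: "fps_exp 1 * ?E = 1"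
    by (simp flip: fps_exp_add_mult)
  \<comment> \<open>The denominator is restored through \<open>e^t - 1 = -e^t (e^(-t) - 1)\<close>,
    so that it can be cancelled at the end.\<close>
  have "(bernoulli_gf x oo - fps_X) * (fps_exp 1 - 1)
      = - (fps_exp 1 * ((bernoulli_gf x oo - fps_X) * (?E - 1)))"
    using i by (simp add: algebra_simps)
  also have "\<dots> = fps_X * (fps_exp 1 * fps_exp (- x))"
    by (simp add: r mult_ac)
  also have "\<dots> = fps_X * fps_exp (1 - x)"
    by (simp flip: fps_exp_add_mult)
  also have "\<dots> = bernoulli_gf (1 - x) * (fps_exp 1 - 1)"
    by (simp only: bernoulli_gf_mult)
  finally show ?thesis
    using fps_exp_minus_one_nonzero by (metis mult_right_cancel)
qed

lemma bernoulli_poly_add: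
  "bernoulli_poly r (x + c) =
    (\<Sum>k\<le>r. of_nat (r choose k) * c ^ (r - k) * bernoulli_poly k (x :: 'a::field_char_0))"
proof -
  have "bernoulli_poly r (x + c) =
      (\<Sum>k\<le>r. fact r * (fps_nth (bernoulli_gf x) k * (c ^ (r - k) / fact (r - k))))"
    by (simp add: bernoulli_poly_def bernoulli_gf_add fps_mult_nth sum_distrib_left atLeast0AtMost)
  also have "\<dots> = (\<Sum>k\<le>r. of_nat (r choose k) * c ^ (r - k) * bernoulli_poly k x)"
    by (intro sum.cong refl) (simp add: bernoulli_poly_def binomial_fact)
  finally show ?thesis .
qed

lemma bernoulli_poly_reflect:
  "bernoulli_poly r (1 - x) = (- 1) ^ r * bernoulli_poly r (x :: 'a::field_char_0)"
  by (simp add: bernoulli_poly_def bernoulli_gf_reflect fps_compose_uminus' mult_ac)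

definition bernoulli_umbra :: "'a::field_char_0 \<Rightarrow> 'a poly \<Rightarrow> 'a" where
  "bernoulli_umbra x p = (\<Sum>r\<le>degree p. coeff p r * bernoulli_poly r x)"

text \<open>Coefficients above the degree vanish. A common bound \<open>N\<close> for several
  polynomials makes additivity a termwise computation.\<close>

lemma bernoulli_umbra_altdef:
  assumes "degree p \<le> N"
  shows "bernoulli_umbra x p = (\<Sum>r\<le>N. coeff p r * bernoulli_poly r x)"
  unfolding bernoulli_umbra_def
  using assms by (intro sum.mono_neutral_left) (auto simp: coeff_eq_0)

lemma bernoulli_umbra_add: "bernoulli_umbra x (p + q) = bernoulli_umbra x p + bernoulli_umbra x q"
proof -
  let ?N = "max (degree p) (degree q)"
  have "degree (p + q) \<le> ?N" by (rule degree_add_le_max)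
  then show ?thesis
    by (simp add: bernoulli_umbra_altdef[of _ ?N] sum.distrib algebra_simps)
qed

lemma bernoulli_umbra_smult: "bernoulli_umbra x (smult c p) = c * bernoulli_umbra x p"
  by (simp add: bernoulli_umbra_altdef[of _ "degree p"] degree_smult_le sum_distrib_left mult_ac)

lemma bernoulli_umbra_sum: "bernoulli_umbra x (sum f A) = (\<Sum>i\<in>A. bernoulli_umbra x (f i))"
  by (induction A rule: infinite_finite_induct)
    (simp_all add: bernoulli_umbra_add, simp_all add: bernoulli_umbra_def)

text \<open>Since \<open>-4 - y = -(y + 4)\<close>, the addition formula with \<open>c = 4\<close>
  yields \<open>(-1)^r B_r(x + 4)\<close>, and reflection at \<open>x + 4\<close> turns this into
  \<open>B_r(1 - (x + 4))\<close>.\<close>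

lemma bernoulli_umbra_linear_power:
  "bernoulli_umbra x ([:- 4, - 1:] ^ r) = bernoulli_poly r (- x - 3 :: 'a::field_char_0)"
proof -
  have p: "[:- 4, - 1:] ^ r = smult ((- 1) ^ r) ([:4, 1:] ^ r :: 'a poly)"
    by (simp flip: smult_power)
  have "bernoulli_umbra x ([:4, 1:] ^ r) = bernoulli_poly r (x + 4)"
    by (subst bernoulli_umbra_altdef[of _ r])
      (simp_all add: degree_linear_power coeff_linear_poly_power bernoulli_poly_add)
  moreover have "bernoulli_poly r (- x - 3) = (- 1) ^ r * bernoulli_poly r (x + 4)"
    using bernoulli_poly_reflect[of r "x + 4"] by (simp add: algebra_simps)
  ultimately show ?thesis
    by (simp add: p bernoulli_umbra_smult)
qed

lemma bernoulli_umbra_reflect: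
  "bernoulli_umbra (- x - 3) p = bernoulli_umbra x (pcompose p [:- 4, - 1:])"
proof -
  have "pcompose p [:- 4, - 1:] = (\<Sum>r\<le>degree p. smult (coeff p r) ([:- 4, - 1:] ^ r))"
    by (simp add: pcompose_altdef poly_altdef degree_map_poly coeff_map_poly)
  then show ?thesis
    by (simp only: bernoulli_umbra_sum bernoulli_umbra_smult bernoulli_umbra_linear_power)
      (simp add: bernoulli_umbra_def)
qed

text \<open>In terms of the classical polynomials, \<open>shifted_cheb (n + 1) (y) = U\<^sub>n(1 + y/2)\<close>.\<close>

fun shifted_cheb :: "nat \<Rightarrow> 'a::comm_ring_1 poly" where
  "shifted_cheb 0 = 0"
| "shifted_cheb (Suc 0) = 1"
| "shifted_cheb (Suc (Suc n)) = [:2, 1:] * shifted_cheb (Suc n) - shifted_cheb n"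

text \<open>With \<open>m = n + r\<close> and \<open>k = 2r + 1\<close>, the recurrence becomes
  \<open>C(m+2,k) = 2 C(m+1,k) + C(m,k-2) - C(m,k)\<close>, which follows from Pascal's rule; for
  \<open>r = 0\<close> the middle term is absent.\<close>

lemma coeff_shifted_cheb:
  "coeff (shifted_cheb n) r = (of_nat ((n + r) choose (2 * r + 1)) :: 'a::comm_ring_1)"
proof (induction n arbitrary: r rule: shifted_cheb.induct)
  case (1 r)
  then show ?case by (simp add: binomial_eq_0)
next
  case (2 r)
  then show ?case by (cases r) (simp_all add: coeff_1 binomial_eq_0)
next
  case (3 n r)
  have "coeff (shifted_cheb (Suc (Suc n)) :: 'a poly) r =
      2 * coeff (shifted_cheb (Suc n)) r + (case r of 0 \<Rightarrow> 0 | Suc s \<Rightarrow> coeff (shifted_cheb (Suc n)) s)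
        - coeff (shifted_cheb n) r"
    by (simp add: coeff_pCons)
  also have "\<dots> = of_nat ((Suc (Suc n) + r) choose (2 * r + 1))"
    by (cases r) (simp_all add: "3.IH" algebra_simps)
  finally show ?case .
qed

lemma degree_shifted_cheb: "degree (shifted_cheb n :: 'a::comm_ring_1 poly) \<le> n - 1"
  by (rule degree_le) (auto simp: coeff_shifted_cheb binomial_eq_0)

text \<open>This is the parity of the Chebyshev polynomials: the substitution sends
  \<open>2 + y\<close> to \<open>-(2 + y)\<close>. The extra minus sign comes from the index shift,
  \<open>shifted_cheb n\<close> belonging to \<open>U\<close> of index \<open>n - 1\<close>.\<close>

lemma pcompose_shifted_cheb:
  "pcompose (shifted_cheb n) [:- 4, - 1:] = (smult (- ((- 1) ^ n)) (shifted_cheb n) :: 'a::comm_ring_1 poly)"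
proof (induction n rule: shifted_cheb.induct)
  case (3 n)
  have l: "pcompose [:2, 1:] [:- 4, - 1:] = (- [:2, 1:] :: 'a poly)"
    by (simp add: pcompose_pCons)
  show ?case
    unfolding shifted_cheb.simps pcompose_diff pcompose_mult l 3
    by (simp add: smult_diff_right del: mult_pCons_left minus_pCons)
qed (simp_all add: pcompose_1)

text \<open>Both sides equal \<open>C(n+r,2r) + C(n+r-1,2r)\<close>: the left by absorption, the
  right by Pascal's rule applied twice.\<close>

lemma zagier_coefficient:
  assumes "n \<ge> 1" "r \<le> n"
  shows "2 * of_nat n * (of_nat ((n + r) choose (2 * r)) / of_nat (n + r)) =
    (of_nat ((Suc n + r) choose (2 * r + 1)) - of_nat ((n - 1 + r) choose (2 * r + 1))
      :: 'a::field_char_0)"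
proof -
  obtain m where m: "n + r = Suc m" using assms by (cases "n + r") auto
  have m': "n - 1 + r = m" using assms m by simp
  \<comment> \<open>Absorption trades the factor \<open>n - r\<close> for \<open>n + r\<close>;
    writing \<open>2n = (n + r) + (n - r)\<close> then lets the denominator cancel.\<close>
  have "Suc m * (m choose (2 * r)) = (Suc m - 2 * r) * (Suc m choose (2 * r))"
    by (metis binomial_absorb_comp diff_Suc_1)
  moreover have "Suc m - 2 * r = n - r" using m by simp
  ultimately have "of_nat (Suc m) * of_nat (m choose (2 * r)) =
      (of_nat n - of_nat r) * (of_nat (Suc m choose (2 * r)) :: 'a)"
    using assms by (metis of_nat_diff of_nat_mult)
  moreover have "of_nat (Suc m) = (of_nat n + of_nat r :: 'a)"
    by (metis m of_nat_add)
  ultimately have "2 * of_nat n * of_nat (Suc m choose (2 * r)) =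
      (of_nat (Suc m) * (of_nat (Suc m choose (2 * r)) + of_nat (m choose (2 * r))) :: 'a)"
    by (simp only: distrib_left) (simp add: algebra_simps)
  then have "2 * of_nat n * (of_nat (Suc m choose (2 * r)) / of_nat (Suc m)) =
      (of_nat (Suc m choose (2 * r)) + of_nat (m choose (2 * r)) :: 'a)"
    by (simp add: nonzero_divide_eq_eq mult_ac del: of_nat_Suc binomial_Suc_Suc)
  moreover have "Suc (Suc m) choose (2 * r + 1) =
      (Suc m choose (2 * r)) + (m choose (2 * r)) + (m choose (2 * r + 1))"
    by simp
  ultimately show ?thesis
    using m by (simp only: m m' add_Suc of_nat_add) simp
qed

lemma zagier_poly_umbra:
  assumes "n \<ge> 1"
  shows "2 * of_nat n * zagier_poly n x =
    bernoulli_umbra x (shifted_cheb (Suc n) - shifted_cheb (n - 1) :: 'a::field_char_0 poly)"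
proof -
  have "degree (shifted_cheb (Suc n) - shifted_cheb (n - 1) :: 'a poly) \<le> n"
    using degree_shifted_cheb[of "Suc n", where 'a = 'a] degree_shifted_cheb[of "n - 1", where 'a = 'a]
    by (intro degree_diff_le) auto
  then have "bernoulli_umbra x (shifted_cheb (Suc n) - shifted_cheb (n - 1)) =
      (\<Sum>r\<le>n. (of_nat ((Suc n + r) choose (2 * r + 1)) - of_nat ((n - 1 + r) choose (2 * r + 1)))
        * bernoulli_poly r x)"
    by (simp only: bernoulli_umbra_altdef coeff_diff coeff_shifted_cheb)
  also have "\<dots> = (\<Sum>r\<le>n. 2 * of_nat n * (of_nat ((n + r) choose (2 * r)) / of_nat (n + r))
        * bernoulli_poly r x)"
    using assms by (intro sum.cong refl) (simp only: zagier_coefficient atMost_iff)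
  also have "\<dots> = 2 * of_nat n * zagier_poly n x"
    by (simp add: zagier_poly_def sum_distrib_left atLeast0AtMost mult_ac)
  finally show ?thesis ..
qed

theorem theorem11p1:
  fixes n :: nat and x :: "'a::field_char_0"
  assumes "n \<ge> 1"
  shows "zagier_poly n (- x - 3) = (-1) ^ n * zagier_poly n x"
proof -
  let ?q = "shifted_cheb (Suc n) - shifted_cheb (n - 1) :: 'a poly"
  \<comment> \<open>The indices \<open>n + 1\<close> and \<open>n - 1\<close> have equal parity, so
    both terms of \<open>?q\<close> acquire the same sign \<open>(-1)^n\<close>.\<close>
  have "(- 1) ^ n = (- ((- 1) ^ (n - 1)) :: 'a)"
    using assms by (cases n) auto
  then have "pcompose ?q [:- 4, - 1:] = smult ((- 1) ^ n) ?q"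
    by (simp add: pcompose_diff pcompose_shifted_cheb smult_diff_right del: shifted_cheb.simps)
  then have "2 * of_nat n * zagier_poly n (- x - 3) = 2 * of_nat n * ((- 1) ^ n * zagier_poly n x)"
    using zagier_poly_umbra[OF assms, of x] zagier_poly_umbra[OF assms, of "- x - 3"]
    by (simp add: bernoulli_umbra_reflect bernoulli_umbra_smult mult_ac del: shifted_cheb.simps)
  \<comment> \<open>The factor \<open>2n\<close> is nonzero in characteristic 0 and cancels.\<close>
  then show ?thesis
    using assms by simp
qed

end
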